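(* Let $G$ be a finite non-cyclic $2$-group. If $P^*(G)$ is claw-free, then either $G$ has exponent at most $4$ or $G$ is a dihedral group.
   Context: For a group $G$, the power graph $P(G)$ is the simple undirected graph whose vertices are the elements of $G$, two distinct vertices $u,v$ being adjacent if and only if one of them is a power of the other (equivalently, one of $\langle u\rangle,\langle v\rangle$ is contained in the other). The reduced power graph $P^*(G)$ is the subgraph of $P(G)$ induced by the non-identity elements. A graph is claw-free if it has no induced subgraph isomorphic to the complete bipartite graph $K_{1,3}$. *)

theory Defs
  imports "HOL-Algebra.Elementary_Groups" "Graph_Theory.Graph_Theory"
begin

text \<open>
  Simple undirected graphs are loop-free symmetric digraphs, following the locale
  \<^locale>\<open>graph\<close>; an edge is the pair of its two orientations.
\<close>

text \<open>
  Powers are taken with integer exponents, so that being a power of \<open>v\<close> means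
  lying in the cyclic subgroup generated by \<open>v\<close>, whether or not the group is finite.
\<close>
definition power_graph :: "('a, 'b) monoid_scheme \<Rightarrow> ('a, 'a \<times> 'a) pre_digraph" where
  "power_graph G = with_proj \<lparr>
     pverts = carrier G,
     parcs = {(u, v). u \<in> carrier G \<and> v \<in> carrier G \<and> u \<noteq> v \<and>
       ((\<exists>k::int. u = v [^]\<^bsub>G\<^esub> k) \<or> (\<exists>k::int. v = u [^]\<^bsub>G\<^esub> k))} \<rparr>"

definition reduced_power_graph :: "('a, 'b) monoid_scheme \<Rightarrow> ('a, 'a \<times> 'a) pre_digraph" where
  "reduced_power_graph G = power_graph G \<restriction> (carrier G - {\<one>\<^bsub>G\<^esub>})"

definition claw_free :: "('v, 'e) pre_digraph \<Rightarrow> bool" where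
  "claw_free \<Gamma> \<longleftrightarrow> \<not> (\<exists>H. induced_subgraph H \<Gamma> \<and> complete_bipartite_digraph 1 3 H)"

text \<open>Only meaningful if some positive \<open>e\<close> works, as is the case for every finite group.\<close>
definition group_exponent :: "('a, 'b) monoid_scheme \<Rightarrow> nat" where
  "group_exponent G = (LEAST e. 0 < e \<and> (\<forall>x\<in>carrier G. x [^]\<^bsub>G\<^esub> e = \<one>\<^bsub>G\<^esub>))"

text \<open>
  The pair \<open>(i, b)\<close> stands for \<open>r\<^sup>i\<close> if \<open>b\<close> is false and for \<open>r\<^sup>i s\<close> if \<open>b\<close> is true, where
  \<open>r\<close> is the rotation of order \<open>n\<close> and \<open>s\<close> a reflection, so that \<open>s r\<^sup>j = r\<^bsup>-j\<^esup> s\<close>.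
  The order of \<open>dihedral_group n\<close> is \<open>2 n\<close>.
\<close>
definition dihedral_group :: "nat \<Rightarrow> (int \<times> bool) monoid" where
  "dihedral_group n = \<lparr>
     carrier = {0..<int n} \<times> UNIV,
     monoid.mult = (\<lambda>(i, b) (j, c). ((if b then i - j else i + j) mod int n, b \<noteq> c)),
     monoid.one = (0, False) \<rparr>"

text \<open>
  The degenerate cases \<open>n = 1\<close> (cyclic of order 2) and \<open>n = 2\<close> (the Klein four-group)
  are not counted as dihedral.
\<close>
definition is_dihedral_group :: "('a, 'b) monoid_scheme \<Rightarrow> bool" where
  "is_dihedral_group G \<longleftrightarrow> (\<exists>n\<ge>3. G \<cong> dihedral_group n)"

lemma graph_power_graph:
  assumes "finite (carrier G)"
  shows "graph (power_graph G)"
proof -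
  let ?E = "{(u, v). u \<in> carrier G \<and> v \<in> carrier G \<and> u \<noteq> v \<and>
       ((\<exists>k::int. u = v [^]\<^bsub>G\<^esub> k) \<or> (\<exists>k::int. v = u [^]\<^bsub>G\<^esub> k))}"
  have "finite ?E"
    by (rule finite_subset[of _ "carrier G \<times> carrier G"]) (use assms in auto)
  moreover have "sym ?E"
    by (auto simp: sym_def)
  ultimately show ?thesis
    using assms unfolding power_graph_def
    by unfold_locales (auto simp: symmetric_def arc_to_ends_def)
qed

lemma graph_reduced_power_graph:
  assumes "finite (carrier G)"
  shows "graph (reduced_power_graph G)"
proof -
  interpret P: graph "power_graph G"
    using assms by (rule graph_power_graph)
  have ind: "induced_subgraph (reduced_power_graph G) (power_graph G)"
    unfolding reduced_power_graph_def
    by (rule P.induced_induce) (auto simp: power_graph_def)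
  have fin: "finite (verts (reduced_power_graph G))" "finite (arcs (reduced_power_graph G))"
    using assms by (auto simp: reduced_power_graph_def)
  have sym: "symmetric (reduced_power_graph G)"
    using P.sym_arcs ind by (rule induced_graph_imp_symmetric)
  show ?thesis
    using fin sym P.no_loops P.no_multi_arcs
    by unfold_locales (auto simp: reduced_power_graph_def arc_to_ends_def)
qed

lemma group_dihedral_group:
  assumes "n > 0"
  shows "group (dihedral_group n)"
proof (rule groupI)
  fix x assume x: "x \<in> carrier (dihedral_group n)"
  obtain i b where ib: "x = (i, b)" by force
  show "\<exists>y\<in>carrier (dihedral_group n). y \<otimes>\<^bsub>dihedral_group n\<^esub> x = \<one>\<^bsub>dihedral_group n\<^esub>"
  proof (cases b)
    case True
    then show ?thesis
      using x ib by (intro bexI[of _ "(i, b)"]) (auto simp: dihedral_group_def)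
  next
    case False
    then show ?thesis
      using x ib assms
      by (intro bexI[of _ "((- i) mod int n, b)"]) (auto simp: dihedral_group_def mod_simps)
  qed
qed (use assms in \<open>auto simp: dihedral_group_def mod_simps algebra_simps split: if_splits\<close>)

lemma order_dihedral_group: "order (dihedral_group n) = 2 * n"
  by (simp add: order_def dihedral_group_def card_cartesian_product)

end

theory Submission
  imports Defs "HOL-Algebra.Multiplicative_Group" "HOL-Computational_Algebra.Primes"
begin

text \<open>
  Suppose that the exponent exceeds \<open>4\<close>, and choose \<open>x\<close> of maximal order. The order is a
  power of two and at least \<open>8\<close>, and \<open>C = \<langle>x\<rangle>\<close> is a maximal cyclic subgroup with a single
  involution \<open>z\<close>. Three elements whose cyclic subgroups all contain \<open>z\<close> and are pairwise
  incomparable form a claw with centre \<open>z\<close> (\<open>claw_free_cyclic_subgroups\<close>). As \<open>x\<close> can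
  always serve as one of the leaves, the elements outside \<open>C\<close> whose square is a non-trivial element
  of \<open>C\<close> have pairwise comparable cyclic subgroups (\<open>quotient_of_noninvolutions\<close>).

  Now let \<open>y \<notin> C\<close> normalize \<open>C\<close> with \<open>y\<^sup>2 \<in> C\<close>. In the coset \<open>C y\<close> there is no room for
  elements of order above \<open>2\<close>: if \<open>y\<close> were one, then \<open>x y\<close> and \<open>x\<^sup>-\<^sup>1 y\<close> would have to be
  involutions, which makes \<open>\<langle>x, y\<rangle>\<close> look semidihedral, and there \<open>x\<^sup>2 y\<close> has order \<open>4\<close> but is
  not comparable with \<open>y\<close>. So all of \<open>C y\<close> consists of involutions, which means that \<open>y\<close> inverts \<open>C\<close>.
  Since inversion is not the square of an automorphism of \<open>C\<close>, the assumption \<open>y\<^sup>2 \<in> C\<close> can be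
  dropped (\<open>normalizer_inverts\<close>). Hence the normalizer \<open>N\<close> of \<open>C\<close> contains only \<open>C\<close> and
  involutions inverting \<open>C\<close>.

  It remains to see that \<open>C\<close> is normal. If \<open>N\<close> were proper, then some \<open>g \<notin> N\<close> would conjugate \<open>x\<close>
  into \<open>N\<close> (\<open>exists_conjugate_in_proper_subgroup\<close>, a parity count of cosets). The conjugate has
  order above \<open>2\<close>, so it lies in \<open>C\<close>, and \<open>g\<close> normalizes \<open>C\<close> after all. Thus every element outside
  \<open>C\<close> is an involution inverting \<open>C\<close>; the product of two of them centralizes \<open>x\<close> and so lies in
  \<open>C\<close>, and \<open>G\<close> is dihedral, as \<open>G \<noteq> C\<close>.
\<close>

section \<open>Conjugates inside subgroups of a finite 2-group\<close>

lemma even_card_fixed_point_free_involution: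
  assumes "finite X"
    and "\<And>a. a \<in> X \<Longrightarrow> f a \<in> X"
    and "\<And>a. a \<in> X \<Longrightarrow> f (f a) = a"
    and "\<And>a. a \<in> X \<Longrightarrow> f a \<noteq> a"
  shows "even (card X)"
proof -
  let ?P = "(\<lambda>a. {a, f a}) ` X"
  have U: "\<Union>?P = X"
    using assms(2) by auto
  have "2 dvd card (\<Union>?P)"
  proof (rule dvd_partition)
    show "finite (\<Union>?P)"
      using U assms(1) by simp
    have "card {a, f a} = 2" if "a \<in> X" for a
      using assms(4)[OF that] by auto
    then show "\<forall>p\<in>?P. 2 dvd card p"
      by auto
    show "\<forall>p\<in>?P. \<forall>q\<in>?P. p \<noteq> q \<longrightarrow> p \<inter> q = {}"
      using assms(3) by (auto simp: doubleton_eq_iff) metis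
  qed
  then show ?thesis
    using U by simp
qed

text \<open>
  The map \<open>f\<close> acts as an involution on the fixed points of \<open>f \<circ> f\<close>, and \<open>f \<circ> f\<close> has half the
  period; so the points moved by \<open>f \<circ> f\<close> are even in number by induction, and those moved by \<open>f\<close>
  only are paired off.
\<close>
lemma even_card_moved_points:
  assumes "finite X"
    and "\<And>a. a \<in> X \<Longrightarrow> f a \<in> X"
    and "\<And>a. a \<in> X \<Longrightarrow> (f ^^ (2 ^ k)) a = a"
  shows "even (card {a \<in> X. f a \<noteq> a})"
  using assms
proof (induction k arbitrary: f)
  case 0
  then have "{a \<in> X. f a \<noteq> a} = {}"
    by auto
  then show ?case
    by (simp only: card.empty even_zero)
next
  case (Suc k)
  let ?A = "{a \<in> X. f (f a) \<noteq> a}" and ?B = "{a \<in> X. f a \<noteq> a \<and> f (f a) = a}"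
  have "(f \<circ> f) ^^ (2 ^ k) = f ^^ (2 ^ Suc k)"
    using funpow_mult[where f = f and m = 2 and n = "2 ^ k"] by (simp add: numeral_2_eq_2)
  then have "((f \<circ> f) ^^ (2 ^ k)) a = a" if "a \<in> X" for a
    using Suc.prems(3)[OF that] by simp
  then have "even (card {a \<in> X. (f \<circ> f) a \<noteq> a})"
    using Suc.prems(1,2) by (intro Suc.IH) (auto simp del: comp_apply, simp)
  then have "even (card ?A)"
    by simp
  moreover have "even (card ?B)"
    using Suc.prems(1,2) by (intro even_card_fixed_point_free_involution[of _ f]) auto
  moreover have "{a \<in> X. f a \<noteq> a} = ?A \<union> ?B"
    by auto
  moreover have "card (?A \<union> ?B) = card ?A + card ?B"
    using Suc.prems(1) by (intro card_Un_disjoint) auto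
  ultimately show ?case
    by simp
qed

text \<open>
  The element \<open>x\<close> acts on the cosets of \<open>H\<close> by right multiplication. Their number is even, so the
  number of fixed cosets is even too. As \<open>H\<close> itself is fixed, there is another fixed coset
  \<open>H g\<close>, which means \<open>g x g\<^sup>-\<^sup>1 \<in> H\<close>. This plays the part that
  the growth of normalizers usually plays in 2-groups.
\<close>
lemma (in group) exists_conjugate_in_proper_subgroup:
  assumes fin: "finite (carrier G)"
    and two: "order G = 2 ^ k"
    and H: "subgroup H G" "H \<noteq> carrier G"
    and x: "x \<in> H"
  shows "\<exists>g\<in>carrier G - H. g \<otimes> x \<otimes> inv g \<in> H"
proof -
  let ?X = "rcosets H" and ?f = "\<lambda>M. M #> x"
  have HG: "H \<subseteq> carrier G" and xG: "x \<in> carrier G"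
    using H(1) x subgroup.subset by blast+
  have XG: "M \<subseteq> carrier G" if "M \<in> ?X" for M
    using that subgroup.rcosets_carrier[OF H(1) group_axioms] by simp
  have pow: "(?f ^^ n) M = M #> (x [^] n)" if "M \<in> ?X" for n M
    using XG[OF that] xG by (induction n) (simp_all add: coset_mult_assoc)
  have finX: "finite ?X"
    using fin by (auto simp: RCOSETS_def)
  have ev: "even (card {M \<in> ?X. ?f M \<noteq> M})"
  proof (rule even_card_moved_points[where k = k])
    show "?f M \<in> ?X" if "M \<in> ?X" for M
      using that HG xG by (auto simp: RCOSETS_def coset_mult_assoc)
    show "(?f ^^ 2 ^ k) M = M" if "M \<in> ?X" for M
      using pow[OF that] XG[OF that] pow_order_eq_1[OF xG] two by (simp add: coset_mult_one)
  qed (fact finX)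
  have "card ?X * card H = 2 ^ k"
    using lagrange[OF H(1)] two by simp
  moreover have "card ?X \<noteq> 1"
  proof
    assume "card ?X = 1"
    then have "card H = card (carrier G)"
      using lagrange[OF H(1)] by (simp add: order_def)
    then show False
      using H(2) HG fin card_subset_eq by blast
  qed
  ultimately have "even (card ?X)"
    using divides_primepow_nat[OF two_is_prime_nat, of "card ?X" k]
    by (metis dvd_triv_left even_numeral even_power gr0I power_0)
  moreover have "card ?X = card {M \<in> ?X. ?f M \<noteq> M} + card {M \<in> ?X. ?f M = M}"
    using finX by (subst card_Un_disjoint[symmetric]) (auto intro: arg_cong[where f = card])
  ultimately have "even (card {M \<in> ?X. ?f M = M})"
    using ev by simp
  moreover have "H \<in> {M \<in> ?X. ?f M = M}"
    using coset_join2[OF xG H(1) x] rcosetsI[OF HG one_closed] coset_mult_one[OF HG] by simp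
  ultimately have "{M \<in> ?X. ?f M = M} \<noteq> {H}"
    by (metis card.empty card.insert empty_iff finite.emptyI odd_one One_nat_def)
  then obtain M where M: "M \<in> ?X" "M #> x = M" "M \<noteq> H"
    using \<open>H \<in> {M \<in> ?X. ?f M = M}\<close> by blast
  then obtain g where g: "g \<in> carrier G" "M = H #> g"
    by (auto simp: RCOSETS_def)
  have "g \<notin> H"
    using coset_join2[OF g(1) H(1)] g(2) M(3) by blast
  moreover have "H #> (g \<otimes> x \<otimes> inv g) = H"
    using M(2) g xG HG by (metis coset_mult_assoc coset_mult_inv2 coset_mult_one r_inv inv_closed m_closed)
  then have "g \<otimes> x \<otimes> inv g \<in> H"
    by (rule coset_join1) (use g(1) xG H(1) in simp_all)
  ultimately show ?thesis
    using g(1) by blast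
qed

section \<open>Claws in the reduced power graph\<close>

text \<open>
  Two non-identity elements are adjacent or equal precisely when their cyclic subgroups are
  comparable. So \<open>c\<close> is the centre, and \<open>u\<close>, \<open>v\<close>, \<open>w\<close> are the leaves of an induced claw unless two
  of the leaves are comparable. That \<open>c\<close> differs from the leaves follows from their being
  incomparable.
\<close>
lemma (in group) claw_free_cyclic_subgroups:
  assumes fin: "finite (carrier G)"
    and cf: "claw_free (reduced_power_graph G)"
    and c: "c \<noteq> \<one>"
    and G: "u \<in> carrier G" "v \<in> carrier G" "w \<in> carrier G"
    and cu: "c \<in> generate G {u}" "c \<in> generate G {v}" "c \<in> generate G {w}"
    and uv: "u \<notin> generate G {v}" "v \<notin> generate G {u}"
    and uw: "u \<notin> generate G {w}" "w \<notin> generate G {u}"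
  shows "v \<in> generate G {w} \<or> w \<in> generate G {v}"
proof (rule ccontr)
  assume "\<not> ?thesis"
  then have vw: "v \<notin> generate G {w}" "w \<notin> generate G {v}"
    by auto
  let ?\<Gamma> = "reduced_power_graph G" and ?S = "{c, u, v, w}"
  let ?H = "with_proj \<lparr>pverts = ?S, parcs = {c} \<times> {u, v, w} \<union> {u, v, w} \<times> {c}\<rparr>"
  have cG: "c \<in> carrier G"
    using cu(1) G(1) generate_incl[of "{u}"] by blast
  have self: "b \<in> generate G {b}" for b
    by (rule generate.incl) simp
  have one: "\<one> \<in> generate G {b}" for b
    by (rule generate.one)
  have trans: "a \<in> generate G {d}" if "a \<in> generate G {b}" "b \<in> generate G {d}" "d \<in> carrier G" for a b d
    using that generate_subgroup_incl[OF _ generate_is_subgroup, of "{b}" "{d}"] by auto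
  have non1: "u \<noteq> \<one>" "v \<noteq> \<one>" "w \<noteq> \<one>"
    using uv uw vw one by auto
  have nc: "u \<notin> generate G {c}" "v \<notin> generate G {c}" "w \<notin> generate G {c}"
    using trans cu uv uw G by blast+
  have dist: "c \<noteq> u" "c \<noteq> v" "c \<noteq> w" "u \<noteq> v" "u \<noteq> w" "v \<noteq> w"
    using nc uv uw vw self by auto
  have arcs: "arcs ?\<Gamma> = {(a, b). a \<in> carrier G - {\<one>} \<and> b \<in> carrier G - {\<one>} \<and> a \<noteq> b \<and>
      (a \<in> generate G {b} \<or> b \<in> generate G {a})}"
    by (auto simp: reduced_power_graph_def power_graph_def generate_pow)
  have th: "tail ?\<Gamma> = fst" "head ?\<Gamma> = snd" "verts ?\<Gamma> = carrier G - {\<one>}"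
    by (auto simp: reduced_power_graph_def power_graph_def)
  have adj: "c \<in> generate G {b}" "b \<in> carrier G - {\<one>}" "c \<noteq> b" if "b \<in> {u, v, w}" for b
    using that cu G non1 dist by auto
  have nonadj: "a \<notin> generate G {b}" if "a \<in> {u, v, w}" "b \<in> {u, v, w}" "a \<noteq> b" for a b
    using that uv uw vw by auto
  have "arcs ?H = {e \<in> arcs ?\<Gamma>. fst e \<in> ?S \<and> snd e \<in> ?S}"
  proof (intro equalityI subsetI)
    fix e assume "e \<in> arcs ?H"
    then consider b where "e = (c, b)" "b \<in> {u, v, w}" | b where "e = (b, c)" "b \<in> {u, v, w}"
      by force
    then show "e \<in> {e \<in> arcs ?\<Gamma>. fst e \<in> ?S \<and> snd e \<in> ?S}"
      unfolding arcs using adj c cG by cases (simp_all, blast+)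
  next
    fix e assume e: "e \<in> {e \<in> arcs ?\<Gamma>. fst e \<in> ?S \<and> snd e \<in> ?S}"
    obtain a b where ab: "e = (a, b)"
      by fastforce
    have "a \<noteq> b" "a \<in> generate G {b} \<or> b \<in> generate G {a}"
      using e unfolding ab arcs by simp_all
    then have "\<not> (a \<in> {u, v, w} \<and> b \<in> {u, v, w})"
      using nonadj by metis
    then show "e \<in> arcs ?H"
      using e \<open>a \<noteq> b\<close> unfolding ab by simp blast
  qed
  moreover have "wf_digraph ?\<Gamma>"
    using graph_reduced_power_graph[OF fin]
    by (simp add: graph_def digraph_def fin_digraph_def)
  moreover have "wf_digraph ?H"
    by unfold_locales auto
  ultimately have "induced_subgraph ?H ?\<Gamma>"
    using c cG G non1 by (auto simp: induced_subgraph_def subgraph_def compatible_def th)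
  moreover have "complete_bipartite_digraph 1 3 ?H"
    unfolding complete_bipartite_digraph_pair_def
    using dist by (intro conjI exI[of _ "{c}"] exI[of _ "{u, v, w}"]) auto
  ultimately show False
    using cf unfolding claw_free_def by blast
qed

section \<open>A maximal cyclic subgroup of order at least eight\<close>
lemma not_four_dvd_square_plus_one: "\<not> 4 dvd a * a + (1::nat)"
proof -
  have "(a * a + 1) mod 4 = ((a mod 4) * (a mod 4) + 1) mod 4"
    by (metis mod_add_left_eq mod_mult_eq)
  moreover have "a mod 4 = 0 \<or> a mod 4 = 1 \<or> a mod 4 = 2 \<or> a mod 4 = 3"
    by arith
  ultimately show ?thesis
    by (auto simp: dvd_eq_mod_eq_0)
qed

lemma (in group) inv_mult_cancel:
  assumes "a \<in> carrier G" "b \<in> carrier G"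
  shows "inv a \<otimes> (a \<otimes> b) = b" "a \<otimes> (inv a \<otimes> b) = b"
  using assms by (simp_all flip: m_assoc)

lemma (in group) nat_pow_conjugate:
  assumes "g \<in> carrier G" "a \<in> carrier G"
  shows "(g \<otimes> a \<otimes> inv g) [^] (n::nat) = g \<otimes> a [^] n \<otimes> inv g"
  using assms by (induction n) (simp_all add: m_assoc inv_mult_cancel)

text \<open>
  The element \<open>x\<close> of maximal order is carried along as a parameter. Maximality of its order makes
  \<open>\<langle>x\<rangle>\<close> a maximal cyclic subgroup.
\<close>
locale claw_free_2_group = group G for G (structure) +
  fixes k :: nat and x
  assumes finite_carrier: "finite (carrier G)"
    and order_two_power: "order G = 2 ^ k"
    and claw_free: "claw_free (reduced_power_graph G)"
    and x_carrier [simp]: "x \<in> carrier G"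
    and ord_le: "g \<in> carrier G \<Longrightarrow> ord g \<le> ord x"
    and pow_4: "x [^] (4::nat) \<noteq> \<one>"
begin

abbreviation C where "C \<equiv> generate G {x}"

lemma nat_pow_in_generate:
  assumes "a \<in> carrier G"
  shows "a [^] (n::nat) \<in> generate G {a}"
  using generate_pow_on_finite_carrier[OF finite_carrier assms] by auto

lemma subgroup_C: "subgroup C G"
  by (rule generate_is_subgroup) simp

lemmas C_closed [simp] = subgroup.m_closed[OF subgroup_C] subgroup.m_inv_closed[OF subgroup_C]

lemma C_carrier [simp]: "c \<in> C \<Longrightarrow> c \<in> carrier G"
  using subgroup.mem_carrier[OF subgroup_C] .

lemma x_in_C [simp]: "x \<in> C"
  by (rule generate.incl) simp

lemma C_iff: "c \<in> C \<longleftrightarrow> (\<exists>n::nat. c = x [^] n)"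
  using generate_pow_on_finite_carrier[OF finite_carrier x_carrier] by auto

lemma C_commute:
  assumes "c \<in> C" "d \<in> C"
  shows "c \<otimes> d = d \<otimes> c"
  using assms by (auto simp: C_iff nat_pow_mult add.commute)

lemma mult_notin_C:
  assumes "c \<in> C" "g \<in> carrier G" "g \<notin> C"
  shows "c \<otimes> g \<notin> C"
proof
  assume "c \<otimes> g \<in> C"
  then have "inv c \<otimes> (c \<otimes> g) \<in> C"
    using assms(1) by simp
  then show False
    using assms by (simp add: inv_mult_cancel)
qed

lemma generate_mono:
  assumes "a \<in> generate G {b}" "b \<in> carrier G"
  shows "generate G {a} \<subseteq> generate G {b}"
  using assms by (intro generate_subgroup_incl generate_is_subgroup) auto

lemma generate_square_subset:
  assumes "a \<in> carrier G"
  shows "generate G {a \<otimes> a} \<subseteq> generate G {a}"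
  using generate_mono[of "a \<otimes> a" a] nat_pow_in_generate[of a 2] assms
  by (simp add: numeral_2_eq_2)

lemma x_squared_nontrivial: "x \<otimes> x \<noteq> \<one>"
proof
  assume "x \<otimes> x = \<one>"
  moreover have "x [^] (4::nat) = (x \<otimes> x) \<otimes> (x \<otimes> x)"
    by (simp add: numeral_eq_Suc m_assoc)
  ultimately show False
    using pow_4 by simp
qed

lemma four_dvd_ord: "4 dvd ord x"
proof -
  have "ord x dvd 2 ^ k"
    using ord_dvd_group_order[OF x_carrier] order_two_power by simp
  then obtain j where j: "ord x = 2 ^ j"
    by (auto simp: divides_primepow_nat)
  have "\<not> ord x dvd 4"
    using pow_4 pow_eq_id[OF x_carrier] by blast
  then have "\<not> j \<le> 2"
    using j le_imp_power_dvd[of j 2 "2::nat"] by auto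
  then have "2 \<le> j"
    by simp
  then show ?thesis
    using j le_imp_power_dvd[of 2 j "2::nat"] by simp
qed

lemma ord_x_pos: "ord x > 0"
  using ord_ge_1[OF finite_carrier x_carrier] by simp

text \<open>
  Repeated squaring takes \<open>g\<close> into \<open>H\<close>, as it ends at the identity. With \<open>H\<close> trivial the last power
  outside is an involution; with \<open>H = C\<close> it has order \<open>2\<close> modulo \<open>C\<close>.
\<close>
lemma last_power_notin:
  assumes H: "subgroup H G" and g: "g \<in> carrier G" "g \<notin> H"
  shows "\<exists>j. g [^] ((2::nat) ^ j) \<notin> H \<and> g [^] ((2::nat) ^ Suc j) \<in> H"
proof -
  have "g [^] ((2::nat) ^ k) = \<one>"
    using pow_order_eq_1[OF g(1)] order_two_power by simp
  then have "g [^] ((2::nat) ^ k) \<in> H"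
    using subgroup.one_closed[OF H] by simp
  then show ?thesis
    using ex_least_nat_less[where P = "\<lambda>j. g [^] ((2::nat) ^ j) \<in> H" and n = k] g by auto
qed

text \<open>The unique involution of \<open>C\<close>.\<close>
definition z where "z = x [^] (ord x div 2)"

lemma z_nontrivial: "z \<noteq> \<one>"
proof
  assume "z = \<one>"
  then have "ord x dvd ord x div 2"
    by (simp add: z_def pow_eq_id)
  then show False
    using ord_x_pos four_dvd_ord by (auto dest!: dvd_imp_le)
qed

text \<open>
  Some power of \<open>c\<close> is an involution, and an involution \<open>x\<^sup>m\<close> of \<open>C\<close> is \<open>z\<close>, because \<open>m\<close> is an odd
  multiple of half the order of \<open>x\<close>.
\<close>
lemma z_in_generate:
  assumes "c \<in> C" "c \<noteq> \<one>"
  shows "z \<in> generate G {c}"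
proof -
  have triv: "subgroup {\<one>} G"
    by (rule triv_subgroup)
  obtain j where j: "c [^] ((2::nat) ^ j) \<noteq> \<one>" "c [^] ((2::nat) ^ Suc j) = \<one>"
    using last_power_notin[OF triv, of c] assms C_carrier by auto
  obtain i :: nat where i: "c = x [^] i"
    using assms(1) C_iff by auto
  define m where "m = i * 2 ^ j"
  obtain h where h: "ord x = 2 * h"
    using four_dvd_ord by (elim dvdE) (use that[of "2 * _"] in simp)
  have m: "c [^] ((2::nat) ^ j) = x [^] m"
    by (simp add: i m_def nat_pow_pow)
  have "\<not> 2 * h dvd m"
    using j(1) m h pow_eq_id[OF x_carrier] by metis
  have "2 * h dvd 2 * m"
    using j(2) h pow_eq_id[OF x_carrier, of "2 * m"]
    by (simp add: i m_def nat_pow_pow algebra_simps)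
  then have "h dvd m"
    by simp
  then obtain q where q: "m = h * q"
    by (rule dvdE)
  have "odd q"
  proof
    assume "even q"
    then obtain p where "q = 2 * p"
      by (rule evenE)
    then show False
      using \<open>\<not> 2 * h dvd m\<close> q by simp
  qed
  then obtain r where r: "q = 2 * r + 1"
    by (auto elim: oddE)
  have "x [^] m = (x [^] ord x) [^] r \<otimes> x [^] h"
    by (simp add: \<open>m = h * q\<close> r h nat_pow_pow nat_pow_mult algebra_simps del: pow_ord_eq_1)
  moreover have "z = x [^] h"
    by (simp add: z_def h)
  ultimately have "x [^] m = z"
    by simp
  then show ?thesis
    using m nat_pow_in_generate[of c "2 ^ j"] assms(1) by simp
qed

lemma x_notin_generate:
  assumes "g \<in> carrier G" "g \<notin> C"
  shows "x \<notin> generate G {g}"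
proof
  assume "x \<in> generate G {g}"
  then have sub: "C \<subseteq> generate G {g}"
    using generate_mono assms(1) by blast
  moreover have "card (generate G {g}) \<le> card C"
    using ord_le[OF assms(1)] generate_pow_card assms(1) by simp
  moreover have "finite (generate G {g})"
    using generate_incl[of "{g}"] assms(1) finite_carrier by (auto intro: finite_subset)
  ultimately have "C = generate G {g}"
    by (simp add: card_seteq)
  then show False
    using assms(2) generate.incl[of g "{g}"] by auto
qed

section \<open>Elements outside the maximal cyclic subgroup\<close>

text \<open>Even powers of \<open>v\<close> lie in \<open>C\<close>, so \<open>u\<close> is an odd power of \<open>v\<close>.\<close>
lemma quotient_in_generate_square:
  assumes v: "v \<in> carrier G" "v \<otimes> v \<in> C"
    and u: "u \<notin> C" "u \<in> generate G {v}"
  shows "u \<otimes> inv v \<in> generate G {v \<otimes> v}"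
proof -
  obtain n :: nat where n: "u = v [^] n"
    using u(2) generate_pow_on_finite_carrier[OF finite_carrier v(1)] by auto
  have sq: "v [^] (2 * m) = (v \<otimes> v) [^] m" for m :: nat
    using v(1) nat_pow_pow[of v 2 m] by (simp add: numeral_2_eq_2)
  have "odd n"
  proof
    assume "even n"
    then obtain m where "n = 2 * m"
      by (auto elim: evenE)
    then show False
      using u(1) n sq generate_mono[OF v(2)] nat_pow_in_generate[of "v \<otimes> v" m] v(1) by auto
  qed
  then obtain m where "n = Suc (2 * m)"
    by (auto elim: oddE)
  then have "u \<otimes> inv v = (v \<otimes> v) [^] m"
    using n v(1) sq by (simp add: m_assoc)
  then show ?thesis
    using nat_pow_in_generate[of "v \<otimes> v" m] v(1) by simp
qed

text \<open>
  The squares of \<open>u\<close> and \<open>v\<close> are non-trivial elements of \<open>C\<close>, so \<open>z\<close> is a power of each of \<open>x\<close>,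
  \<open>u\<close> and \<open>v\<close>. Maximality of \<open>C\<close> makes \<open>x\<close> incomparable with \<open>u\<close> and \<open>v\<close>; absence of claws then
  forces \<open>u\<close> and \<open>v\<close> to be comparable.
\<close>
lemma quotient_of_noninvolutions:
  assumes u: "u \<in> carrier G" "u \<notin> C" "u \<otimes> u \<in> C" "u \<otimes> u \<noteq> \<one>"
    and v: "v \<in> carrier G" "v \<notin> C" "v \<otimes> v \<in> C" "v \<otimes> v \<noteq> \<one>"
  shows "u \<otimes> inv v \<in> generate G {u \<otimes> u} \<union> generate G {v \<otimes> v}"
proof -
  have "u \<in> generate G {v} \<or> v \<in> generate G {u}"
  proof (rule claw_free_cyclic_subgroups[OF finite_carrier claw_free z_nontrivial x_carrier u(1) v(1)])
    show "z \<in> generate G {x}"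
      using z_in_generate x_in_C x_squared_nontrivial by fastforce
    show "z \<in> generate G {u}" "z \<in> generate G {v}"
      using z_in_generate generate_square_subset u v by blast+
    show "x \<notin> generate G {u}" "x \<notin> generate G {v}"
      using x_notin_generate u v by blast+
  qed (use u v in auto)
  then show ?thesis
  proof
    assume "u \<in> generate G {v}"
    then show ?thesis
      using quotient_in_generate_square[OF v(1,3) u(2)] by blast
  next
    assume "v \<in> generate G {u}"
    then have "inv (v \<otimes> inv u) \<in> generate G {u \<otimes> u}"
      using quotient_in_generate_square[OF u(1,3) v(2)] u(1)
        subgroup.m_inv_closed[OF generate_is_subgroup[of "{u \<otimes> u}"]] by simp
    then show ?thesis
      using u(1) v(1) by (simp add: inv_mult_group)
  qed
qed

lemma square_mult_left:
  assumes "c \<in> carrier G" "y \<in> carrier G"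
  shows "(c \<otimes> y) \<otimes> (c \<otimes> y) = c \<otimes> (y \<otimes> c \<otimes> inv y) \<otimes> (y \<otimes> y)"
  using assms by (simp add: m_assoc inv_mult_cancel)

text \<open>
  Suppose that \<open>s = y\<^sup>2\<close> is not trivial and write \<open>t = y x y\<^sup>-\<^sup>1\<close>. For \<open>c = x\<close> and \<open>c = x\<^sup>-\<^sup>1\<close> the
  square of \<open>c y\<close> is trivial: otherwise \<open>c = (c y) y\<^sup>-\<^sup>1\<close> would be a power of \<open>c y\<close> or of \<open>y\<close>,
  against the maximality of \<open>C\<close>. This gives \<open>x t s = 1\<close> and \<open>s = x t\<close>, hence \<open>s\<^sup>2 = 1\<close>. It follows that
  \<open>(x\<^sup>2 y)\<^sup>2 = x\<^sup>2 t\<^sup>2 s = s \<noteq> 1\<close>, so the comparison applies to \<open>x\<^sup>2 y\<close> and makes \<open>x\<^sup>2\<close> a power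
  of \<open>s\<close>. But then \<open>x\<^sup>4 = 1\<close>.
\<close>
lemma square_eq_one_of_normalizing:
  assumes y: "y \<in> carrier G" "y \<notin> C" "y \<otimes> y \<in> C" and yx: "y \<otimes> x \<otimes> inv y \<in> C"
  shows "y \<otimes> y = \<one>"
proof (rule ccontr)
  define s where "s = y \<otimes> y"
  define t where "t = y \<otimes> x \<otimes> inv y"
  assume "y \<otimes> y \<noteq> \<one>"
  then have s: "s \<in> C" "s \<noteq> \<one>" and t: "t \<in> C"
    using y yx by (auto simp: s_def t_def)
  \<comment> \<open>Here \<open>c d s\<close> is the square of \<open>c y\<close>, and \<open>c\<close> is the quotient of \<open>c y\<close> by \<open>y\<close>.\<close>
  have quot: "c \<in> generate G {c \<otimes> d \<otimes> s} \<union> generate G {s}"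
    if c: "c \<in> C" and d: "d \<in> C" "d = y \<otimes> c \<otimes> inv y" and ne: "c \<otimes> d \<otimes> s \<noteq> \<one>" for c d
  proof -
    have sq: "(c \<otimes> y) \<otimes> (c \<otimes> y) = c \<otimes> d \<otimes> s"
      using c y d(2) by (simp add: s_def square_mult_left)
    have "c \<otimes> y \<otimes> inv y \<in> generate G {(c \<otimes> y) \<otimes> (c \<otimes> y)} \<union> generate G {y \<otimes> y}"
    proof (rule quotient_of_noninvolutions)
      show "(c \<otimes> y) \<otimes> (c \<otimes> y) \<in> C" "(c \<otimes> y) \<otimes> (c \<otimes> y) \<noteq> \<one>"
        unfolding sq using c d(1) s(1) ne by simp_all
      show "y \<otimes> y \<noteq> \<one>"
        using s(2) by (simp add: s_def)
    qed (use c y mult_notin_C[OF c y(1,2)] in simp_all)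
    moreover have "c \<otimes> y \<otimes> inv y = c"
      using c y(1) by (simp add: m_assoc)
    ultimately show ?thesis
      unfolding sq s_def by simp
  qed
  have square_eq_one: "c \<otimes> d \<otimes> s = \<one>"
    if c: "c = x \<or> c = inv x" and d: "d \<in> C" "d = y \<otimes> c \<otimes> inv y" for c d
  proof (rule ccontr)
    assume ne: "c \<otimes> d \<otimes> s \<noteq> \<one>"
    have cC: "c \<in> C"
      using c by auto
    have sq: "(c \<otimes> y) \<otimes> (c \<otimes> y) = c \<otimes> d \<otimes> s"
      using cC y d(2) by (simp add: s_def square_mult_left)
    have "c \<in> generate G {c \<otimes> y} \<union> generate G {y}"
      using quot[OF cC d ne] generate_square_subset[of "c \<otimes> y"] generate_square_subset[of y] cC y(1) sq s_def by auto
    then have "\<exists>g\<in>carrier G - C. c \<in> generate G {g}"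
      using mult_notin_C[OF cC y(1,2)] y(1,2) m_closed[OF C_carrier[OF cC] y(1)] by blast
    then obtain g where g: "g \<in> carrier G" "g \<notin> C" "c \<in> generate G {g}"
      by blast
    have "x \<in> generate G {g}"
      using c g subgroup.m_inv_closed[OF generate_is_subgroup[of "{g}"], of c] by auto
    then show False
      using x_notin_generate g by blast
  qed
  have 1: "x \<otimes> t \<otimes> s = \<one>"
    using square_eq_one[of x t] t by (simp add: t_def)
  have inv_t: "inv t = y \<otimes> inv x \<otimes> inv y"
    using y(1) by (simp add: t_def inv_mult_group m_assoc)
  have 2: "inv x \<otimes> inv t \<otimes> s = \<one>"
    using square_eq_one[OF disjI2[OF refl] C_closed(2)[OF t] inv_t] .
  have tx: "s = x \<otimes> t"
  proof -
    have "inv (t \<otimes> x) \<otimes> s = \<one>"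
      using 2 t by (simp add: inv_mult_group)
    then have "t \<otimes> x = s"
      using inv_mult_cancel(2)[of "t \<otimes> x" s] s(1) t by simp
    then show ?thesis
      using C_commute[OF t x_in_C] by simp
  qed
  have ss: "s \<otimes> s = \<one>"
    using 1 tx by simp
  have tt: "y \<otimes> (x \<otimes> x) \<otimes> inv y = t \<otimes> t"
    using y(1) by (simp add: t_def m_assoc inv_mult_cancel)
  have "(x \<otimes> x) \<otimes> (t \<otimes> t) = s \<otimes> s"
  proof -
    have "(x \<otimes> x) \<otimes> (t \<otimes> t) = x \<otimes> (x \<otimes> t) \<otimes> t"
      using t by (simp add: m_assoc)
    also have "\<dots> = x \<otimes> (t \<otimes> x) \<otimes> t"
      using C_commute[OF t x_in_C] by simp
    also have "\<dots> = s \<otimes> s"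
      using t by (simp add: tx m_assoc)
    finally show ?thesis .
  qed
  then have eq: "(x \<otimes> x) \<otimes> (t \<otimes> t) \<otimes> s = s"
    using ss s(1) by simp
  have "x \<otimes> x \<in> generate G {s}"
    using quot[OF C_closed(1)[OF x_in_C x_in_C] C_closed(1)[OF t t] tt[symmetric], unfolded eq]
      s(2) by blast
  then obtain n :: nat where n: "x \<otimes> x = s [^] n"
    using generate_pow_on_finite_carrier[OF finite_carrier, of s] s(1) by auto
  have "(x \<otimes> x) \<otimes> (x \<otimes> x) = (s \<otimes> s) [^] n"
    using s(1) n pow_mult_distrib[of s s n] by simp
  then have "x [^] (4::nat) = \<one>"
    using ss by (simp add: numeral_eq_Suc m_assoc)
  then show False
    using pow_4 by simp
qed

text \<open>
  The element \<open>x y\<close> satisfies the same hypotheses as \<open>y\<close>, so both are involutions, and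
  \<open>x y x y = 1\<close> is the claim.
\<close>
lemma inverts_of_normalizing:
  assumes y: "y \<in> carrier G" "y \<notin> C" "y \<otimes> y \<in> C" and yx: "y \<otimes> x \<otimes> inv y \<in> C"
  shows "y \<otimes> x \<otimes> inv y = inv x"
proof -
  define t where "t = y \<otimes> x \<otimes> inv y"
  have t: "t \<in> C"
    using yx by (simp add: t_def)
  have sq: "(x \<otimes> y) \<otimes> (x \<otimes> y) = x \<otimes> t"
    using square_mult_left[of x y] square_eq_one_of_normalizing[OF y yx] y(1) t
    by (simp add: t_def)
  have "(x \<otimes> y) \<otimes> x \<otimes> inv (x \<otimes> y) = x \<otimes> t \<otimes> inv x"
    using y(1) by (simp add: t_def m_assoc inv_mult_group)
  then have "(x \<otimes> y) \<otimes> (x \<otimes> y) = \<one>"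
    using y t sq mult_notin_C[OF x_in_C y(1,2)]
    by (intro square_eq_one_of_normalizing) simp_all
  then have "t \<otimes> x = \<one>"
    using sq C_commute[OF t x_in_C] by simp
  then show ?thesis
    using t inv_equality[of t x] by (simp add: t_def)
qed

text \<open>
  Squaring \<open>g\<close> repeatedly gives an element \<open>w \<notin> C\<close> with \<open>w\<^sup>2 \<in> C\<close>, which inverts \<open>x\<close> by the
  previous lemmas. If \<open>w\<close> is the square of some \<open>h\<close> that maps \<open>x\<close> to \<open>x\<^sup>a\<close>, then \<open>a\<^sup>2 = -1\<close> modulo
  the order of \<open>x\<close>, which is impossible modulo \<open>4\<close>. So no squaring took place, and \<open>w = g\<close>.
\<close>
lemma normalizer_inverts:
  assumes g: "g \<in> carrier G" "g \<notin> C" and gx: "g \<otimes> x \<otimes> inv g \<in> C"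
  shows "g \<otimes> g = \<one>" "g \<otimes> x \<otimes> inv g = inv x"
proof -
  have conj: "g \<otimes> c \<otimes> inv g \<in> C" if "c \<in> C" for c
  proof -
    obtain n :: nat where "c = x [^] n"
      using \<open>c \<in> C\<close> C_iff by auto
    then have "g \<otimes> c \<otimes> inv g = (g \<otimes> x \<otimes> inv g) [^] n"
      using g(1) by (simp add: nat_pow_conjugate)
    then show ?thesis
      using generate_mono[OF gx x_carrier] nat_pow_in_generate[of "g \<otimes> x \<otimes> inv g" n] g(1) by auto
  qed
  have norm: "g [^] n \<otimes> x \<otimes> inv (g [^] n) \<in> C" for n :: nat
  proof (induction n)
    case (Suc n)
    have "g [^] Suc n \<otimes> x \<otimes> inv (g [^] Suc n) = g \<otimes> (g [^] n \<otimes> x \<otimes> inv (g [^] n)) \<otimes> inv g"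
      using g(1) nat_pow_Suc2[OF g(1), of n] by (simp add: inv_mult_group m_assoc del: nat_pow_Suc)
    then show ?case
      using conj Suc.IH by simp
  qed simp
  obtain j where j: "g [^] ((2::nat) ^ j) \<notin> C" "g [^] ((2::nat) ^ Suc j) \<in> C"
    using last_power_notin[OF subgroup_C g] by blast
  define w where "w = g [^] ((2::nat) ^ j)"
  have w: "w \<in> carrier G" "w \<notin> C" "w \<otimes> w \<in> C" "w \<otimes> x \<otimes> inv w \<in> C"
    using j g(1) norm by (auto simp: w_def nat_pow_mult mult_2)
  have "j = 0"
  proof (rule ccontr)
    assume "j \<noteq> 0"
    then obtain i where i: "j = Suc i"
      by (cases j) auto
    define h where "h = g [^] ((2::nat) ^ i)"
    have h: "h \<in> carrier G" "w = h \<otimes> h"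
      using g(1) by (auto simp: h_def w_def i nat_pow_mult mult_2)
    obtain a :: nat where a: "h \<otimes> x \<otimes> inv h = x [^] a"
      using norm[of "2 ^ i"] by (auto simp: h_def C_iff)
    have "w \<otimes> x \<otimes> inv w = h \<otimes> (h \<otimes> x \<otimes> inv h) \<otimes> inv h"
      using h by (simp add: m_assoc inv_mult_group)
    also have "\<dots> = (h \<otimes> x \<otimes> inv h) [^] a"
      using h by (subst a) (simp add: nat_pow_conjugate)
    also have "\<dots> = x [^] (a * a)"
      by (simp add: a nat_pow_pow)
    finally have "inv x = x [^] (a * a)"
      using inverts_of_normalizing[OF w] by simp
    then have "x [^] (a * a + 1) = \<one>"
      by (simp add: nat_pow_mult[symmetric] flip: \<open>inv x = x [^] (a * a)\<close>)
    then have "4 dvd a * a + 1"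
      using four_dvd_ord pow_eq_id[OF x_carrier] dvd_trans by blast
    then show False
      using not_four_dvd_square_plus_one by blast
  qed
  then have "w = g"
    using g(1) by (simp add: w_def)
  then show "g \<otimes> g = \<one>" "g \<otimes> x \<otimes> inv g = inv x"
    using w square_eq_one_of_normalizing inverts_of_normalizing by auto
qed

lemma conj_in_C_iff:
  assumes "g \<in> carrier G"
  shows "g \<otimes> x \<otimes> inv g \<in> C \<longleftrightarrow> g \<otimes> x \<otimes> inv g = x \<or> g \<otimes> x \<otimes> inv g = inv x"
proof (cases "g \<in> C")
  case True
  then show ?thesis
    using C_commute[OF True x_in_C] by (simp add: m_assoc)
next
  case False
  then show ?thesis
    using normalizer_inverts(2)[OF assms False] by auto
qed

section \<open>Normality and the dihedral structure\<close>

text \<open>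
  The stabilizer \<open>N\<close> of \<open>C\<close> under conjugation consists of the elements that fix or invert \<open>x\<close>, which
  is visibly a subgroup. A conjugate of \<open>x\<close> in \<open>N\<close> is not an involution, so it lies in \<open>C\<close>; hence
  no element outside \<open>N\<close> can conjugate \<open>x\<close> into \<open>N\<close>, and \<open>N\<close> is not proper.
\<close>
lemma normalizes_C:
  assumes "g \<in> carrier G"
  shows "g \<otimes> x \<otimes> inv g \<in> C"
proof -
  define N where "N = {g \<in> carrier G. g \<otimes> x \<otimes> inv g \<in> C}"
  have N_iff: "g \<in> N \<longleftrightarrow> g \<in> carrier G \<and> (g \<otimes> x \<otimes> inv g = x \<or> g \<otimes> x \<otimes> inv g = inv x)" for g
    using conj_in_C_iff by (auto simp: N_def)
  have "subgroup N G"
  proof (rule subgroupI)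
    fix g h assume gh: "g \<in> N" "h \<in> N"
    then have G: "g \<in> carrier G" "h \<in> carrier G"
      by (auto simp: N_def)
    have "(g \<otimes> h) \<otimes> x \<otimes> inv (g \<otimes> h) = g \<otimes> (h \<otimes> x \<otimes> inv h) \<otimes> inv g"
      using G by (simp add: m_assoc inv_mult_group)
    moreover have "g \<otimes> inv x \<otimes> inv g = inv (g \<otimes> x \<otimes> inv g)"
      using G by (simp add: m_assoc inv_mult_group)
    ultimately show "g \<otimes> h \<in> N"
      using gh by (auto simp: N_iff)
  next
    fix g assume g: "g \<in> N"
    then have G: "g \<in> carrier G"
      by (auto simp: N_def)
    have "x = inv g \<otimes> (g \<otimes> x \<otimes> inv g) \<otimes> g"
      using G by (simp add: m_assoc inv_mult_cancel)
    moreover have "inv g \<otimes> inv x \<otimes> g = inv (inv g \<otimes> x \<otimes> g)"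
      using G by (simp add: m_assoc inv_mult_group)
    ultimately show "inv g \<in> N"
      using g G by (auto simp: N_iff) (metis inv_inv inv_closed m_closed x_carrier)
  qed (auto simp: N_def intro!: exI[of _ \<one>])
  moreover have "x \<in> N"
    by (simp add: N_iff m_assoc)
  moreover have "\<not> (\<exists>g\<in>carrier G - N. g \<otimes> x \<otimes> inv g \<in> N)"
  proof
    assume "\<exists>g\<in>carrier G - N. g \<otimes> x \<otimes> inv g \<in> N"
    then obtain g where g: "g \<in> carrier G" "g \<notin> N" "g \<otimes> x \<otimes> inv g \<in> N"
      by blast
    define h where "h = g \<otimes> x \<otimes> inv g"
    have "h \<in> carrier G" "h \<notin> C" "h \<otimes> x \<otimes> inv h \<in> C"
      using g by (auto simp: h_def N_def)
    then have "h \<otimes> h = \<one>"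
      using normalizer_inverts(1) by blast
    moreover have "x \<otimes> x = inv g \<otimes> (h \<otimes> h) \<otimes> g"
      using g(1) by (simp add: h_def m_assoc inv_mult_cancel)
    ultimately show False
      using x_squared_nontrivial g(1) by simp
  qed
  ultimately have "N = carrier G"
    using exists_conjugate_in_proper_subgroup[OF finite_carrier order_two_power] by blast
  then show ?thesis
    using assms by (auto simp: N_def)
qed

text \<open>
  The product of two elements inverting \<open>x\<close> centralizes \<open>x\<close>; outside \<open>C\<close> it would have to invert
  \<open>x\<close> as well.
\<close>
lemma mult_in_C:
  assumes g: "g \<in> carrier G" "g \<notin> C" and y: "y \<in> carrier G" "y \<notin> C"
  shows "g \<otimes> y \<in> C"
proof (rule ccontr)
  assume gy: "g \<otimes> y \<notin> C"
  have "inv x = (g \<otimes> y) \<otimes> x \<otimes> inv (g \<otimes> y)"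
    using normalizer_inverts(2)[of "g \<otimes> y"] normalizes_C gy g y by simp
  also have "\<dots> = g \<otimes> (y \<otimes> x \<otimes> inv y) \<otimes> inv g"
    using g y by (simp add: m_assoc inv_mult_group)
  also have "\<dots> = inv (g \<otimes> x \<otimes> inv g)"
    using g y normalizer_inverts(2)[of y] normalizes_C by (simp add: m_assoc inv_mult_group)
  also have "\<dots> = x"
    using normalizer_inverts(2)[of g] normalizes_C g by simp
  finally show False
    using x_squared_nontrivial by (metis r_inv x_carrier)
qed

text \<open>
  With any \<open>y \<notin> C\<close> as the reflection, \<open>(i, b)\<close> goes to \<open>x\<^sup>i\<close> or \<open>x\<^sup>i y\<close>. The map is onto because
  \<open>g = (g y) y\<close> with \<open>g y \<in> C\<close> for every \<open>g \<notin> C\<close>.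
\<close>
lemma is_dihedral:
  assumes "\<not> cyclic_group G"
  shows "is_dihedral_group G"
proof -
  let ?n = "ord x" and ?D = "dihedral_group (ord x)"
  have "C \<noteq> carrier G"
  proof
    assume "C = carrier G"
    moreover have "C = range (\<lambda>n::int. x [^] n)"
      unfolding generate_pow[OF x_carrier] by auto
    ultimately show False
      using assms cyclic_group x_carrier by blast
  qed
  then obtain y where y: "y \<in> carrier G" "y \<notin> C"
    using subgroup.subset[OF subgroup_C] by blast
  have yy: "y \<otimes> y = \<one>" and yx: "y \<otimes> x \<otimes> inv y = inv x"
    using normalizer_inverts[OF y] normalizes_C y by auto
  have int_pow_C [simp]: "x [^] (i::int) \<in> C" for i
    using generate_pow[OF x_carrier] by auto
  have y_inv: "y \<otimes> c = inv c \<otimes> y" if "c \<in> C" for c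
  proof -
    obtain m :: nat where m: "c = x [^] m"
      using \<open>c \<in> C\<close> C_iff by auto
    have "y \<otimes> c \<otimes> inv y = inv c"
      using nat_pow_conjugate[of y x m] y(1) yx by (simp add: m nat_pow_inv)
    then show ?thesis
      using y(1) that by (metis C_carrier inv_solve_right' inv_closed m_closed)
  qed
  define \<phi> where "\<phi> = (\<lambda>(i::int, b). x [^] i \<otimes> (if b then y else \<one>))"
  have mod: "x [^] (i mod int ?n) = x [^] i" for i :: int
    by (simp add: int_pow_eq)
  have "\<phi> \<in> iso ?D G"
    unfolding iso_iff
  proof (intro conjI)
    show "\<phi> \<in> hom ?D G"
    proof (rule homI)
      show "\<phi> p \<in> carrier G" for p
        using y by (auto simp: \<phi>_def split: prod.splits)
    next
      fix p q :: "int \<times> bool"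
      obtain i b j c where pq: "p = (i, b)" "q = (j, c)"
        by fastforce
      have y_pow: "y \<otimes> (x [^] j \<otimes> w) = x [^] (- j) \<otimes> (y \<otimes> w)" if "w \<in> carrier G" for w
        using y_inv[of "x [^] j"] y(1) that by (simp add: int_pow_neg flip: m_assoc)
      show "\<phi> (p \<otimes>\<^bsub>?D\<^esub> q) = \<phi> p \<otimes> \<phi> q"
        using y(1) yy y_pow[of \<one>] y_pow[of y]
        by (auto simp: pq \<phi>_def dihedral_group_def mod m_assoc int_pow_mult int_pow_diff int_pow_neg)
    qed
    show "inj_on \<phi> (carrier ?D)"
    proof (rule inj_onI)
      fix p q :: "int \<times> bool" assume pq: "p \<in> carrier ?D" "q \<in> carrier ?D" and eq: "\<phi> p = \<phi> q"
      obtain i b j c where ij: "p = (i, b)" "q = (j, c)"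
        by fastforce
      have "b = c"
        using eq mult_notin_C[OF int_pow_C y, of i] mult_notin_C[OF int_pow_C y, of j]
        by (auto simp: ij \<phi>_def split: if_splits) (metis int_pow_C)+
      moreover from this have "x [^] i = x [^] j"
        using eq y by (auto simp: ij \<phi>_def split: if_splits)
      then have "i mod int ?n = j mod int ?n"
        by (simp add: int_pow_eq mod_eq_dvd_iff dvd_diff_commute)
      then have "i = j"
        using pq by (auto simp: ij dihedral_group_def)
      ultimately show "p = q"
        by (simp add: ij)
    qed
    show "\<phi> ` carrier ?D = carrier G"
    proof
      show "\<phi> ` carrier ?D \<subseteq> carrier G"
        using y by (auto simp: \<phi>_def split: prod.splits)
      have C_img: "c \<otimes> (if b then y else \<one>) \<in> \<phi> ` carrier ?D" if "c \<in> C" for c b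
      proof -
        obtain i :: int where "c = x [^] i"
          using \<open>c \<in> C\<close> generate_pow[OF x_carrier] by auto
        then have "c \<otimes> (if b then y else \<one>) = \<phi> (i mod int ?n, b)"
          by (simp add: \<phi>_def mod)
        then show ?thesis
          using ord_x_pos by (auto simp: dihedral_group_def)
      qed
      show "carrier G \<subseteq> \<phi> ` carrier ?D"
      proof
        fix g assume g: "g \<in> carrier G"
        show "g \<in> \<phi> ` carrier ?D"
        proof (cases "g \<in> C")
          case True
          then show ?thesis
            using C_img[of g False] by simp
        next
          case False
          have "g \<otimes> y \<otimes> y = g"
            using g y yy by (simp add: m_assoc)
          then show ?thesis
            using C_img[OF mult_in_C[OF g False y], of True] by simp
        qed
      qed
    qed
  qed
  then have "G \<cong> ?D"
    using group.iso_sym[OF group_dihedral_group[OF ord_x_pos]] by (auto simp: is_iso_def)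
  moreover have "ord x \<ge> 3"
    using four_dvd_ord ord_x_pos by (auto dest: dvd_imp_le)
  ultimately show ?thesis
    by (auto simp: is_dihedral_group_def)
qed

end

theorem proposition2p7:
  fixes G :: "('a, 'b) monoid_scheme"
  assumes "group G"
    and "finite (carrier G)"
    and "\<exists>k. order G = 2 ^ k"
    and "\<not> cyclic_group G"
    and "claw_free (reduced_power_graph G)"
  shows "group_exponent G \<le> 4 \<or> is_dihedral_group G"
proof (cases "\<forall>g\<in>carrier G. g [^]\<^bsub>G\<^esub> (4::nat) = \<one>\<^bsub>G\<^esub>")
  case True
  then show ?thesis
    unfolding group_exponent_def by (intro disjI1 Least_le) simp
next
  case False
  interpret group G
    by (fact assms(1))
  obtain k where k: "order G = 2 ^ k"
    using assms(3) by blast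
  have ord_pow: "\<exists>j. ord g = 2 ^ j" if "g \<in> carrier G" for g
    using ord_dvd_group_order[OF that] k by (auto simp: divides_primepow_nat)
  obtain g where g: "g \<in> carrier G" "g [^]\<^bsub>G\<^esub> (4::nat) \<noteq> \<one>\<^bsub>G\<^esub>"
    using False by blast
  have "Max (ord ` carrier G) \<in> ord ` carrier G"
    using assms(2) by (intro Max_in) auto
  then obtain x where x: "x \<in> carrier G" "ord x = Max (ord ` carrier G)"
    by auto
  have ord_le: "ord h \<le> ord x" if "h \<in> carrier G" for h
    using that x(2) assms(2) by simp
  have "x [^]\<^bsub>G\<^esub> (4::nat) \<noteq> \<one>\<^bsub>G\<^esub>"
  proof
    assume "x [^]\<^bsub>G\<^esub> (4::nat) = \<one>\<^bsub>G\<^esub>"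
    then have "ord x \<le> 4"
      using x(1) by (simp add: pow_eq_id dvd_imp_le)
    obtain j where j: "ord g = 2 ^ j"
      using ord_pow[OF g(1)] by blast
    have "(2::nat) ^ j \<le> 2 ^ 2"
      using ord_le[OF g(1)] \<open>ord x \<le> 4\<close> j by simp
    then have "j \<le> 2"
      by (subst (asm) power_increasing_iff) simp_all
    then have "ord g dvd 2 ^ 2"
      unfolding j by (rule le_imp_power_dvd)
    then show False
      using g by (simp add: pow_eq_id)
  qed
  then interpret claw_free_2_group G k x
    using assms k x(1) ord_le by unfold_locales auto
  show ?thesis
    using is_dihedral[OF assms(4)] by blast
qed

end
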